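(* Consider problems (A), (FA) and (CONIC) defined in the context. The fluid model (A) is equivalent to problem (FA), i.e. it has the same optimal value. Moreover, if $r_{ij}(d_{ij})d_{ij}$ is concave in $d_{ij}$ for every $(i,j)\in\mathcal E$, then (FA) is a convex optimization problem (maximization of a concave function over a convex set) and it is equivalent to the convex conic problem (CONIC).
   Context: $\mathcal N$ is a finite set of nodes and $\mathcal E\subseteq\mathcal N\times\mathcal N$; $\delta^+(j)=\{k:(j,k)\in\mathcal E\}$, $\delta^-(j)=\{i:(i,j)\in\mathcal E\}$. Given are $\beta>0$, $\alpha_{ij}>0$, $b_{ij}$, $q_{ij}\in(0,1)$, $\lambda_j>0$, and inverse demand functions $r_{ij}(\cdot)$ of nonnegative demand rates. Convention: $0\cdot\ln(0/\cdot)=0$. (A), the fluid model: $$\max_{\mathbf d,\mathbf x,\mathbf w,\mathbf y,\bar{\boldsymbol\lambda},\mathbf v}\ \sum_{(i,j)\in\mathcal E}r_{ij}(d_{ij})d_{ij}-\frac1\beta\Big[\ln\Big(\frac{x_{ij}}{w_i}\Big)+\alpha_{ij}\Big]\bar\lambda_iy_{ij}-b_{ij}(d_{ij}-\bar\lambda_iy_{ij})$$ s.t. $\sum_{i\in\delta^-(j)}q_{ij}\bar\lambda_iy_{ij}+\lambda_j=\bar\lambda_j\big(\sum_{k\in\delta^+(j)}y_{jk}+v_j\big)$, $\sum_{k\in\delta^+(j)}x_{jk}+w_j=1$, $\sum_{k\in\delta^+(j)}y_{jk}+v_j=1$ for all $j\in\mathcal N$; $\bar\lambda_iy_{ij}\le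 d_{ij}$, $y_{ij}\le x_{ij}$ for all $(i,j)\in\mathcal E$; $x_{ij},y_{ij},w_i,v_i,\bar\lambda_i\ge0$. (FA): $$\max_{\mathbf d,\bar{\mathbf y},\bar{\mathbf v}}\ \sum_{(i,j)\in\mathcal E}r_{ij}(d_{ij})d_{ij}-\frac1\beta\Big[\ln\Big(\frac{\bar y_{ij}}{\bar v_i}\Big)+\alpha_{ij}\Big]\bar y_{ij}-b_{ij}(d_{ij}-\bar y_{ij})$$ s.t. $\sum_{i\in\delta^-(j)}q_{ij}\bar y_{ij}+\lambda_j=\sum_{k\in\delta^+(j)}\bar y_{jk}+\bar v_j$ for all $j\in\mathcal N$; $0\le\bar y_{ij}\le d_{ij}$ for all $(i,j)\in\mathcal E$; $\bar v_i\ge0$ for all $i\in\mathcal N$. (CONIC): $$\max_{\mathbf d,\bar{\mathbf y},\bar{\mathbf v},\boldsymbol\tau}\ \sum_{(i,j)\in\mathcal E}r_{ij}(d_{ij})d_{ij}-\frac{\alpha_{ij}}\beta\bar y_{ij}-\tau_{ij}-b_{ij}(d_{ij}-\bar y_{ij})$$ s.t. $\sum_{i\in\delta^-(j)}q_{ij}\bar y_{ij}+\lambda_j=\sum_{k\in\delta^+(j)}\bar y_{jk}+\bar v_j$ for all $j\in\mathcal N$; $\bar y_{ij}\le d_{ij}$ and $(\bar v_i,\bar y_{ij},-\beta\tau_{ij})\in K_{\exp}$ for all $(i,j)\in\mathcal E$, where $K_{\exp}=\{\boldsymbol\xi\in\mathbb R^3:\xi_0\ge\xi_1\exp(\xi_2/\xi_1),\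 \xi_0,\xi_1\ge0\}$ is the exponential cone (with the usual closure convention at $\xi_1=0$: $\xi_0\ge0$, $\xi_2\le0$). *)

theory Defs
  imports "HOL-Analysis.Analysis"
begin

(*
  The set of nodes is the finite type 'n and the edge set is E :: ('n * 'n) set.
  A vector indexed by E is a matrix real^'n^'n that vanishes outside E
  (edge_vec), which identifies R^E with a linear subspace of real^'n^'n.
*)

definition out_nbrs :: "('n \<times> 'n) set \<Rightarrow> 'n \<Rightarrow> 'n set" where
  "out_nbrs E j = {k. (j, k) \<in> E}"

definition in_nbrs :: "('n \<times> 'n) set \<Rightarrow> 'n \<Rightarrow> 'n set" where
  "in_nbrs E j = {i. (i, j) \<in> E}"

definition edge_vec :: "('n \<times> 'n) set \<Rightarrow> real^'n^'n \<Rightarrow> bool" where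
  "edge_vec E x \<longleftrightarrow> (\<forall>i j. (i, j) \<notin> E \<longrightarrow> x $ i $ j = 0)"

(*
  ln (x / w) for x, w >= 0 with values in the extended reals: infinity if w = 0 and
  -infinity if x = 0 < w.  Since 0 * (\<plusminus>\<infinity>) = 0 on ereal, the convention
  0 * ln (0 / _) = 0 holds for products with ln_ratio, and so do 0 * ln (x / 0) = 0 and
  y * ln (x / 0) = \<infinity> for y > 0.
*)
definition ln_ratio :: "real \<Rightarrow> real \<Rightarrow> ereal" where
  "ln_ratio x w = (if w = 0 then \<infinity> else if x = 0 then -\<infinity> else ereal (ln (x / w)))"

definition opt_value :: "'a set \<Rightarrow> ('a \<Rightarrow> ereal) \<Rightarrow> ereal" where
  "opt_value S f = (SUP z\<in>S. f z)"

(* The counterpart of concave_on for functions with values in [-\<infinity>, \<infinity>). *)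
definition ereal_concave_on :: "'a::real_vector set \<Rightarrow> ('a \<Rightarrow> ereal) \<Rightarrow> bool" where
  "ereal_concave_on S f \<longleftrightarrow> convex S \<and> (\<forall>x\<in>S. f x \<noteq> \<infinity>) \<and>
     (\<forall>x\<in>S. \<forall>y\<in>S. \<forall>u\<ge>0. \<forall>v\<ge>0. u + v = 1 \<longrightarrow>
        ereal u * f x + ereal v * f y \<le> f (u *\<^sub>R x + v *\<^sub>R y))"


text \<open>Problem (A), with variables \<open>(d, x, w, y, lb, v)\<close>, where \<open>lb\<close> is
  \<open>\<lambda>\<close> with a bar.\<close>

type_synonym 'n a_vars =
  "(real^'n^'n) \<times> (real^'n^'n) \<times> (real^'n) \<times> (real^'n^'n) \<times> (real^'n) \<times> (real^'n)"

definition A_feasible ::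
  "('n::finite \<times> 'n) set \<Rightarrow> ('n \<Rightarrow> 'n \<Rightarrow> real) \<Rightarrow> ('n \<Rightarrow> real) \<Rightarrow> 'n a_vars set" where
  "A_feasible E q lam = {(d, x, w, y, lb, v).
     edge_vec E d \<and> edge_vec E x \<and> edge_vec E y \<and>
     (\<forall>j. (\<Sum>i\<in>in_nbrs E j. q i j * (lb $ i) * (y $ i $ j)) + lam j
            = (lb $ j) * ((\<Sum>k\<in>out_nbrs E j. y $ j $ k) + v $ j)) \<and>
     (\<forall>j. (\<Sum>k\<in>out_nbrs E j. x $ j $ k) + w $ j = 1) \<and>
     (\<forall>j. (\<Sum>k\<in>out_nbrs E j. y $ j $ k) + v $ j = 1) \<and>
     (\<forall>(i, j)\<in>E. (lb $ i) * (y $ i $ j) \<le> d $ i $ j \<and> y $ i $ j \<le> x $ i $ j) \<and>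
     (\<forall>(i, j)\<in>E. 0 \<le> x $ i $ j \<and> 0 \<le> y $ i $ j) \<and>
     (\<forall>i. 0 \<le> w $ i \<and> 0 \<le> v $ i \<and> 0 \<le> lb $ i)}"

definition A_objective ::
  "('n::finite \<times> 'n) set \<Rightarrow> real \<Rightarrow> ('n \<Rightarrow> 'n \<Rightarrow> real) \<Rightarrow> ('n \<Rightarrow> 'n \<Rightarrow> real) \<Rightarrow>
   ('n \<Rightarrow> 'n \<Rightarrow> real \<Rightarrow> real) \<Rightarrow> 'n a_vars \<Rightarrow> ereal" where
  "A_objective E \<beta> \<alpha> b r = (\<lambda>(d, x, w, y, lb, v). \<Sum>(i, j)\<in>E.
       ereal (r i j (d $ i $ j) * (d $ i $ j))
     - ereal (1 / \<beta>) * ((ln_ratio (x $ i $ j) (w $ i) + ereal (\<alpha> i j))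
                        * ereal ((lb $ i) * (y $ i $ j)))
     - ereal (b i j * (d $ i $ j - (lb $ i) * (y $ i $ j))))"


text \<open>Problem (FA), with variables \<open>(d, y, v)\<close>.\<close>

type_synonym 'n fa_vars = "(real^'n^'n) \<times> (real^'n^'n) \<times> (real^'n)"

definition flow_balance ::
  "('n::finite \<times> 'n) set \<Rightarrow> ('n \<Rightarrow> 'n \<Rightarrow> real) \<Rightarrow> ('n \<Rightarrow> real) \<Rightarrow> real^'n^'n \<Rightarrow> real^'n \<Rightarrow> bool" where
  "flow_balance E q lam y v \<longleftrightarrow>
     (\<forall>j. (\<Sum>i\<in>in_nbrs E j. q i j * (y $ i $ j)) + lam j
            = (\<Sum>k\<in>out_nbrs E j. y $ j $ k) + v $ j)"

definition FA_feasible ::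
  "('n::finite \<times> 'n) set \<Rightarrow> ('n \<Rightarrow> 'n \<Rightarrow> real) \<Rightarrow> ('n \<Rightarrow> real) \<Rightarrow> 'n fa_vars set" where
  "FA_feasible E q lam = {(d, y, v).
     edge_vec E d \<and> edge_vec E y \<and> flow_balance E q lam y v \<and>
     (\<forall>(i, j)\<in>E. 0 \<le> y $ i $ j \<and> y $ i $ j \<le> d $ i $ j) \<and>
     (\<forall>i. 0 \<le> v $ i)}"

definition FA_objective ::
  "('n::finite \<times> 'n) set \<Rightarrow> real \<Rightarrow> ('n \<Rightarrow> 'n \<Rightarrow> real) \<Rightarrow> ('n \<Rightarrow> 'n \<Rightarrow> real) \<Rightarrow>
   ('n \<Rightarrow> 'n \<Rightarrow> real \<Rightarrow> real) \<Rightarrow> 'n fa_vars \<Rightarrow> ereal" where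
  "FA_objective E \<beta> \<alpha> b r = (\<lambda>(d, y, v). \<Sum>(i, j)\<in>E.
       ereal (r i j (d $ i $ j) * (d $ i $ j))
     - ereal (1 / \<beta>) * ((ln_ratio (y $ i $ j) (v $ i) + ereal (\<alpha> i j)) * ereal (y $ i $ j))
     - ereal (b i j * (d $ i $ j - y $ i $ j)))"


text \<open>Problem (CONIC), with variables \<open>(d, y, v, \<tau>)\<close>.\<close>

definition K_exp :: "(real \<times> real \<times> real) set" where
  "K_exp = {(\<xi>0, \<xi>1, \<xi>2). 0 \<le> \<xi>0 \<and> 0 \<le> \<xi>1 \<and>
     (if \<xi>1 = 0 then \<xi>2 \<le> 0 else \<xi>1 * exp (\<xi>2 / \<xi>1) \<le> \<xi>0)}"

type_synonym 'n conic_vars =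
  "(real^'n^'n) \<times> (real^'n^'n) \<times> (real^'n) \<times> (real^'n^'n)"

definition CONIC_feasible ::
  "('n::finite \<times> 'n) set \<Rightarrow> real \<Rightarrow> ('n \<Rightarrow> 'n \<Rightarrow> real) \<Rightarrow> ('n \<Rightarrow> real) \<Rightarrow> 'n conic_vars set" where
  "CONIC_feasible E \<beta> q lam = {(d, y, v, \<tau>).
     edge_vec E d \<and> edge_vec E y \<and> edge_vec E \<tau> \<and> flow_balance E q lam y v \<and>
     (\<forall>(i, j)\<in>E. y $ i $ j \<le> d $ i $ j \<and>
                  (v $ i, y $ i $ j, - \<beta> * (\<tau> $ i $ j)) \<in> K_exp)}"

definition CONIC_objective ::
  "('n::finite \<times> 'n) set \<Rightarrow> real \<Rightarrow> ('n \<Rightarrow> 'n \<Rightarrow> real) \<Rightarrow> ('n \<Rightarrow> 'n \<Rightarrow> real) \<Rightarrow>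
   ('n \<Rightarrow> 'n \<Rightarrow> real \<Rightarrow> real) \<Rightarrow> 'n conic_vars \<Rightarrow> real" where
  "CONIC_objective E \<beta> \<alpha> b r = (\<lambda>(d, y, v, \<tau>). \<Sum>(i, j)\<in>E.
       r i j (d $ i $ j) * (d $ i $ j) - \<alpha> i j / \<beta> * (y $ i $ j) - \<tau> $ i $ j
     - b i j * (d $ i $ j - y $ i $ j))"

end

theory Submission
  imports Defs
begin

text \<open>
  Why the theorem holds.

  In (A) the arrival rate \<open>lb\<close> of a node is at least \<open>lam > 0\<close>, so multiplying and dividing
  by it turns a triple \<open>(lb, y, v)\<close> into a pair of absolute flows \<open>(lb * y, lb * v)\<close> and back,
  without changing the ratio \<open>y / v\<close>.  The variables \<open>x\<close> and \<open>w\<close> can be eliminated: \<open>y \<le> x\<close> on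
  every edge and the two normalisations force \<open>w \<le> v\<close>, hence
  \<open>ln (y / v) \<le> ln (x / w)\<close>, and the price term of (A) is cheapest at \<open>x = y\<close>, \<open>w = v\<close>, where it
  is the price term of (FA).

  The feasible set of (CONIC), with its objective, is the part of (FA) with finite objective in
  epigraph form.  The condition \<open>(v, y, - \<beta> * \<tau>) \<in> K_exp\<close> says that \<open>y * ln (y / v) / \<beta>\<close> is finite
  and at most \<open>\<tau>\<close> (lemma \<open>K_exp_iff\<close>).  So every point of (CONIC) projects to a point of (FA) with
  at least the same value, and every point of (FA) with finite value lifts to (CONIC) with the
  same value.  This gives equality of the optimal values.  It also reduces the concavity of the
  extended-real objective of (FA) to that of the real objective of (CONIC): lift two points,
  combine them there, and project.  In (CONIC) everything is linear except \<open>K_exp\<close>, which is a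
  convex cone, and the revenues \<open>r d * d\<close>, which are concave by hypothesis.
\<close>

section \<open>The exponential cone\<close>

text \<open>Being a convex cone amounts to closure under addition and nonnegative scaling.  For
  two points with positive middle coordinates, addition is Jensen's inequality for \<open>exp\<close> with
  the middle coordinates as weights.\<close>

lemma K_exp_add:
  assumes "\<xi> \<in> K_exp" and "\<eta> \<in> K_exp"
  shows "\<xi> + \<eta> \<in> K_exp"
proof -
  obtain a0 a1 a2 where \<xi>: "\<xi> = (a0, a1, a2)" by (cases \<xi>)
  obtain b0 b1 b2 where \<eta>: "\<eta> = (b0, b1, b2)" by (cases \<eta>)
  have a: "0 \<le> a0" "0 \<le> a1" "if a1 = 0 then a2 \<le> 0 else a1 * exp (a2 / a1) \<le> a0"
    and b: "0 \<le> b0" "0 \<le> b1" "if b1 = 0 then b2 \<le> 0 else b1 * exp (b2 / b1) \<le> b0"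
    using assms by (auto simp: \<xi> \<eta> K_exp_def)
  have key: "(a1 + b1) * exp ((a2 + b2) / (a1 + b1)) \<le> a0 + b0" if "a1 + b1 > 0"
  proof -
    consider "a1 = 0" "b1 > 0" | "b1 = 0" "a1 > 0" | "a1 > 0" "b1 > 0"
      using a(2) b(2) \<open>a1 + b1 > 0\<close> by fastforce
    then show ?thesis
    proof cases
      case 1
      then have "b1 * exp ((a2 + b2) / b1) \<le> b1 * exp (b2 / b1)"
        using a by (intro mult_left_mono) (auto simp: divide_right_mono)
      also have "\<dots> \<le> b0" using 1 b(3) by simp
      finally show ?thesis using 1 a(1) by simp
    next
      case 2
      then have "a1 * exp ((a2 + b2) / a1) \<le> a1 * exp (a2 / a1)"
        using b by (intro mult_left_mono) (auto simp: divide_right_mono)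
      also have "\<dots> \<le> a0" using 2 a(3) by simp
      finally show ?thesis using 2 b(1) by simp
    next
      case 3
      have jensen: "exp (u *\<^sub>R x + v *\<^sub>R y) \<le> u * exp x + v * exp y"
        if "0 \<le> u" "0 \<le> v" "u + v = 1" for u v x y :: real
        using exp_convex that unfolding convex_on_def by blast
      define s where "s = a1 + b1"
      have s: "s > 0" using that by (simp add: s_def)
      have "exp ((a1 / s) *\<^sub>R (a2 / a1) + (b1 / s) *\<^sub>R (b2 / b1))
              \<le> a1 / s * exp (a2 / a1) + b1 / s * exp (b2 / b1)"
        using 3 s by (intro jensen) (auto simp: s_def simp flip: add_divide_distrib)
      moreover have "(a1 / s) *\<^sub>R (a2 / a1) + (b1 / s) *\<^sub>R (b2 / b1) = (a2 + b2) / s"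
        using 3 by (simp add: add_divide_distrib)
      ultimately have "s * exp ((a2 + b2) / s) \<le> a1 * exp (a2 / a1) + b1 * exp (b2 / b1)"
        using s by (simp add: pos_le_divide_eq mult.commute flip: add_divide_distrib)
      with 3 a b show ?thesis by (simp add: s_def)
    qed
  qed
  show ?thesis
  proof (cases "a1 + b1 = 0")
    case True
    then have "a1 = 0" "b1 = 0" using a(2) b(2) by linarith+
    then show ?thesis using a b by (simp add: \<xi> \<eta> K_exp_def)
  next
    case False
    then show ?thesis using a b key by (simp add: \<xi> \<eta> K_exp_def)
  qed
qed

lemma K_exp_scaleR:
  assumes "\<xi> \<in> K_exp" and "0 \<le> c"
  shows "c *\<^sub>R \<xi> \<in> K_exp"
proof (cases "c = 0")
  case True
  then show ?thesis by (cases \<xi>) (simp add: K_exp_def)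
next
  case False
  with assms show ?thesis
    by (cases \<xi>) (auto simp: K_exp_def mult_le_0_iff mult.assoc intro!: mult_left_mono split: if_splits)
qed

lemma convex_cone_K_exp: "convex K_exp" "cone K_exp"
proof -
  have "convex K_exp \<and> cone K_exp"
    unfolding convex_cone by (simp add: K_exp_add K_exp_scaleR)
  then show "convex K_exp" "cone K_exp" by simp_all
qed

text \<open>For \<open>y > 0\<close> take logarithms in \<open>y * exp (- \<beta> * t / y) \<le> v\<close>; at \<open>y = 0\<close> the right-hand side
  reads \<open>0 \<le> t\<close>, as the closure convention of the cone demands.\<close>

lemma K_exp_iff:
  assumes "0 < \<beta>"
  shows "(v, y, - \<beta> * t) \<in> K_exp \<longleftrightarrow>
           0 \<le> v \<and> 0 \<le> y \<and> (y = 0 \<or> 0 < v) \<and> y * ln (y / v) / \<beta> \<le> t"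
proof (cases "0 < y \<and> 0 < v")
  case True
  then have "y * exp (- \<beta> * t / y) \<le> v \<longleftrightarrow> exp (- \<beta> * t / y) \<le> v / y"
    by (simp add: field_simps)
  also have "\<dots> \<longleftrightarrow> - \<beta> * t / y \<le> ln (v / y)"
    using True by (subst ln_ge_iff) auto
  also have "\<dots> \<longleftrightarrow> y * ln (y / v) / \<beta> \<le> t"
    using True assms by (simp add: ln_div field_simps)
  finally show ?thesis using True by (simp add: K_exp_def)
next
  case False
  have "\<not> y * exp (- \<beta> * t / y) \<le> 0" if "0 < y"
    using that by (simp add: not_le)
  with False assms show ?thesis
    by (auto simp: K_exp_def mult_le_0_iff zero_le_mult_iff)
qed


section \<open>Logarithmic price terms\<close>

lemma ln_ratio_mono:
  assumes "0 \<le> y" "y \<le> x" "0 \<le> w" "w \<le> v"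
  shows "ln_ratio y v \<le> ln_ratio x w"
proof (cases "0 < y \<and> 0 < w")
  case True
  with assms have "y / v \<le> x / w" by (intro frac_le) auto
  with True assms show ?thesis by (simp add: ln_ratio_def)
next
  case False
  with assms show ?thesis by (auto simp: ln_ratio_def)
qed

lemma ln_ratio_scale: "c \<noteq> 0 \<Longrightarrow> ln_ratio (c * y) (c * v) = ln_ratio y v"
  by (simp add: ln_ratio_def)

lemma price_term_eq:
  assumes "0 \<le> y" "0 \<le> v"
  shows "(ln_ratio y v + ereal a) * ereal y =
           (if y = 0 \<or> 0 < v then ereal (y * ln (y / v) + a * y) else \<infinity>)"
  using assms by (auto simp: ln_ratio_def algebra_simps zero_ereal_def[symmetric])


section \<open>Problems (A) and (FA)\<close>

text \<open>Passing to absolute flows \<open>lb * y\<close>, \<open>lb * v\<close> keeps the ratio \<open>y / v\<close>, because \<open>lb > 0\<close>,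
  and replacing \<open>x / w\<close> by \<open>y / v\<close> can only raise the objective, because \<open>y \<le> x\<close> and hence
  \<open>w = 1 - sum x \<le> 1 - sum y = v\<close>.\<close>

lemma A_le_FA:
  fixes E :: "('n::finite \<times> 'n) set"
  assumes \<beta>: "0 < \<beta>" and q: "\<And>i j. (i, j) \<in> E \<Longrightarrow> 0 \<le> q i j" and lam: "\<And>j. 0 < lam j"
    and A: "z \<in> A_feasible E q lam"
  obtains z' where "z' \<in> FA_feasible E q lam" "A_objective E \<beta> \<alpha> b r z \<le> FA_objective E \<beta> \<alpha> b r z'"
proof -
  obtain d x w y lb v where z: "z = (d, x, w, y, lb, v)" by (cases z)
  have ed: "edge_vec E d" and ey: "edge_vec E y"
    and bal: "\<And>j. (\<Sum>i\<in>in_nbrs E j. q i j * (lb $ i) * (y $ i $ j)) + lam j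
                = (lb $ j) * ((\<Sum>k\<in>out_nbrs E j. y $ j $ k) + v $ j)"
    and sx: "\<And>j. (\<Sum>k\<in>out_nbrs E j. x $ j $ k) + w $ j = 1"
    and sy: "\<And>j. (\<Sum>k\<in>out_nbrs E j. y $ j $ k) + v $ j = 1"
    and dE: "\<And>i j. (i, j) \<in> E \<Longrightarrow> (lb $ i) * (y $ i $ j) \<le> d $ i $ j"
    and yx: "\<And>i j. (i, j) \<in> E \<Longrightarrow> y $ i $ j \<le> x $ i $ j"
    and y0: "\<And>i j. (i, j) \<in> E \<Longrightarrow> 0 \<le> y $ i $ j"
    and w0: "\<And>i. 0 \<le> w $ i" and v0: "\<And>i. 0 \<le> v $ i" and lb0: "\<And>i. 0 \<le> lb $ i"
    using A by (auto simp: A_feasible_def z)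
  have lb_pos: "0 < lb $ j" for j
  proof -
    have "lb $ j = (\<Sum>i\<in>in_nbrs E j. q i j * (lb $ i) * (y $ i $ j)) + lam j"
      using bal[of j] sy[of j] by simp
    also have "0 < \<dots>"
      using lam[of j] by (intro add_nonneg_pos sum_nonneg) (auto simp: in_nbrs_def q y0 lb0)
    finally show ?thesis .
  qed
  have wv: "w $ j \<le> v $ j" for j
  proof -
    have "(\<Sum>k\<in>out_nbrs E j. y $ j $ k) \<le> (\<Sum>k\<in>out_nbrs E j. x $ j $ k)"
      by (intro sum_mono) (auto simp: out_nbrs_def yx)
    with sx[of j] sy[of j] show ?thesis by linarith
  qed
  define y' :: "real^'n^'n" where "y' = (\<chi> i j. lb $ i * y $ i $ j)"
  define v' :: "real^'n" where "v' = (\<chi> i. lb $ i * v $ i)"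
  have "(d, y', v') \<in> FA_feasible E q lam"
    using ed ey bal dE y0 v0 lb0
    by (auto simp: FA_feasible_def flow_balance_def edge_vec_def y'_def v'_def
        distrib_left sum_distrib_left mult.assoc)
  moreover have "A_objective E \<beta> \<alpha> b r z \<le> FA_objective E \<beta> \<alpha> b r (d, y', v')"
    unfolding A_objective_def FA_objective_def z prod.case
  proof (intro sum_mono, clarify)
    fix i j assume ij: "(i, j) \<in> E"
    have "ln_ratio (y' $ i $ j) (v' $ i) \<le> ln_ratio (x $ i $ j) (w $ i)"
      using lb_pos[of i] ln_ratio_mono[OF y0[OF ij] yx[OF ij] w0 wv]
      by (simp add: y'_def v'_def ln_ratio_scale)
    then have "ereal (1 / \<beta>) * ((ln_ratio (y' $ i $ j) (v' $ i) + ereal (\<alpha> i j)) * ereal (y' $ i $ j))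
        \<le> ereal (1 / \<beta>) * ((ln_ratio (x $ i $ j) (w $ i) + ereal (\<alpha> i j)) * ereal (lb $ i * y $ i $ j))"
      using \<beta> y0[OF ij] lb0[of i]
      by (intro ereal_mult_left_mono) (auto simp: y'_def intro!: ereal_mult_right_mono add_right_mono)
    then show "ereal (r i j (d $ i $ j) * (d $ i $ j))
        - ereal (1 / \<beta>) * ((ln_ratio (x $ i $ j) (w $ i) + ereal (\<alpha> i j)) * ereal (lb $ i * y $ i $ j))
        - ereal (b i j * (d $ i $ j - lb $ i * y $ i $ j))
      \<le> ereal (r i j (d $ i $ j) * (d $ i $ j))
        - ereal (1 / \<beta>) * ((ln_ratio (y' $ i $ j) (v' $ i) + ereal (\<alpha> i j)) * ereal (y' $ i $ j))
        - ereal (b i j * (d $ i $ j - y' $ i $ j))"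
      by (intro ereal_minus_mono) (auto simp: y'_def)
  qed
  ultimately show thesis by (rule that)
qed

text \<open>The inverse construction divides by the total inflow, which is positive by \<open>lam > 0\<close>, and
  takes \<open>x = y\<close>, \<open>w = v\<close>.\<close>

lemma FA_le_A:
  fixes E :: "('n::finite \<times> 'n) set"
  assumes q: "\<And>i j. (i, j) \<in> E \<Longrightarrow> 0 \<le> q i j" and lam: "\<And>j. 0 < lam j"
    and FA: "z \<in> FA_feasible E q lam"
  obtains z' where "z' \<in> A_feasible E q lam" "FA_objective E \<beta> \<alpha> b r z = A_objective E \<beta> \<alpha> b r z'"
proof -
  obtain d y v where z: "z = (d, y, v)" by (cases z)
  have ed: "edge_vec E d" and ey: "edge_vec E y"
    and bal: "\<And>j. (\<Sum>i\<in>in_nbrs E j. q i j * (y $ i $ j)) + lam j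
                = (\<Sum>k\<in>out_nbrs E j. y $ j $ k) + v $ j"
    and dE: "\<And>i j. (i, j) \<in> E \<Longrightarrow> y $ i $ j \<le> d $ i $ j"
    and y0: "\<And>i j. (i, j) \<in> E \<Longrightarrow> 0 \<le> y $ i $ j"
    and v0: "\<And>i. 0 \<le> v $ i"
    using FA by (auto simp: FA_feasible_def flow_balance_def z)
  define lb :: "real^'n" where "lb = (\<chi> j. (\<Sum>k\<in>out_nbrs E j. y $ j $ k) + v $ j)"
  have lb_pos: "0 < lb $ j" for j
  proof -
    have "lb $ j = (\<Sum>i\<in>in_nbrs E j. q i j * (y $ i $ j)) + lam j"
      by (simp add: lb_def bal)
    also have "0 < \<dots>"
      using lam[of j] by (intro add_nonneg_pos sum_nonneg) (auto simp: in_nbrs_def q y0)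
    finally show ?thesis .
  qed
  then have lb_nz: "lb $ j \<noteq> 0" for j by (metis less_irrefl)
  define y' :: "real^'n^'n" where "y' = (\<chi> i j. y $ i $ j / lb $ i)"
  define v' :: "real^'n" where "v' = (\<chi> i. v $ i / lb $ i)"
  have y: "y $ i $ j = lb $ i * y' $ i $ j" and v: "v $ i = lb $ i * v' $ i" for i j
    using lb_nz by (auto simp: y'_def v'_def)
  have one: "(\<Sum>k\<in>out_nbrs E j. y' $ j $ k) + v' $ j = 1" for j
  proof -
    have "(\<Sum>k\<in>out_nbrs E j. y' $ j $ k) + v' $ j
            = ((\<Sum>k\<in>out_nbrs E j. y $ j $ k) + v $ j) / lb $ j"
      by (simp add: y'_def v'_def add_divide_distrib sum_divide_distrib)
    also have "\<dots> = lb $ j / lb $ j" by (simp add: lb_def)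
    finally show ?thesis using lb_nz by simp
  qed
  have bal': "(\<Sum>i\<in>in_nbrs E j. q i j * (lb $ i) * (y' $ i $ j)) + lam j
                = (lb $ j) * ((\<Sum>k\<in>out_nbrs E j. y' $ j $ k) + v' $ j)" for j
    using bal[of j] by (simp add: y v distrib_left sum_distrib_left mult.assoc)
  have sgn: "0 \<le> v' $ i" "0 \<le> lb $ i" "(i, j) \<in> E \<Longrightarrow> 0 \<le> y' $ i $ j" for i j
    using v0 y0 lb_pos by (auto simp: y'_def v'_def intro: divide_nonneg_pos less_imp_le)
  have "edge_vec E y'" using ey by (simp add: edge_vec_def y'_def)
  then have "(d, y', v', y', lb, v') \<in> A_feasible E q lam"
    using ed one bal' sgn dE unfolding A_feasible_def by (auto simp: y)
  moreover have "FA_objective E \<beta> \<alpha> b r z = A_objective E \<beta> \<alpha> b r (d, y', v', y', lb, v')"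
    by (simp add: z FA_objective_def A_objective_def y v ln_ratio_scale lb_nz)
  ultimately show thesis by (rule that)
qed

lemma opt_value_A_eq_FA:
  fixes E :: "('n::finite \<times> 'n) set"
  assumes \<beta>: "0 < \<beta>" and q: "\<And>i j. (i, j) \<in> E \<Longrightarrow> 0 \<le> q i j" and lam: "\<And>j. 0 < lam j"
  shows "opt_value (A_feasible E q lam) (A_objective E \<beta> \<alpha> b r)
           = opt_value (FA_feasible E q lam) (FA_objective E \<beta> \<alpha> b r)"
  unfolding opt_value_def
proof (intro antisym SUP_mono)
  fix z assume z: "z \<in> A_feasible E q lam"
  show "\<exists>z'\<in>FA_feasible E q lam. A_objective E \<beta> \<alpha> b r z \<le> FA_objective E \<beta> \<alpha> b r z'"
    by (rule A_le_FA[where \<alpha> = \<alpha> and b = b and r = r, OF \<beta> q lam z]) blast+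
next
  fix z assume z: "z \<in> FA_feasible E q lam"
  show "\<exists>z'\<in>A_feasible E q lam. FA_objective E \<beta> \<alpha> b r z \<le> A_objective E \<beta> \<alpha> b r z'"
    by (rule FA_le_A[where \<beta> = \<beta> and \<alpha> = \<alpha> and b = b and r = r, OF q lam z]) (auto intro: eq_refl)
qed


section \<open>Problem (CONIC) as the epigraph form of (FA)\<close>

text \<open>An edge with \<open>v = 0 < y\<close> contributes \<open>-\<infinity>\<close>.  Since no edge contributes \<open>\<infinity>\<close>, a single such
  edge makes the whole sum \<open>-\<infinity>\<close>; otherwise all terms are real.\<close>

lemma FA_objective_eq:
  fixes E :: "('n::finite \<times> 'n) set"
  assumes \<beta>: "0 < \<beta>" and FA: "(d, y, v) \<in> FA_feasible E q lam"
  shows "FA_objective E \<beta> \<alpha> b r (d, y, v) =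
    (if \<forall>(i, j)\<in>E. y $ i $ j = 0 \<or> 0 < v $ i
     then ereal (\<Sum>(i, j)\<in>E. r i j (d $ i $ j) * (d $ i $ j) - \<alpha> i j / \<beta> * (y $ i $ j)
                   - y $ i $ j * ln (y $ i $ j / v $ i) / \<beta> - b i j * (d $ i $ j - y $ i $ j))
     else -\<infinity>)"
proof -
  define T where "T = (\<lambda>(i, j). if y $ i $ j = 0 \<or> 0 < v $ i
     then ereal (r i j (d $ i $ j) * (d $ i $ j) - \<alpha> i j / \<beta> * (y $ i $ j)
                   - y $ i $ j * ln (y $ i $ j / v $ i) / \<beta> - b i j * (d $ i $ j - y $ i $ j))
     else -\<infinity>)"
  have sgn: "0 \<le> v $ i" "(i, j) \<in> E \<Longrightarrow> 0 \<le> y $ i $ j" for i j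
    using FA by (auto simp: FA_feasible_def)
  have obj: "FA_objective E \<beta> \<alpha> b r (d, y, v) = sum T E"
    unfolding FA_objective_def prod.case
  proof (rule sum.cong[OF refl], clarify)
    fix i j assume "(i, j) \<in> E"
    then have "(ln_ratio (y $ i $ j) (v $ i) + ereal (\<alpha> i j)) * ereal (y $ i $ j)
        = (if y $ i $ j = 0 \<or> 0 < v $ i
           then ereal (y $ i $ j * ln (y $ i $ j / v $ i) + \<alpha> i j * y $ i $ j) else \<infinity>)"
      using sgn by (intro price_term_eq)
    with \<beta> show "ereal (r i j (d $ i $ j) * (d $ i $ j))
       - ereal (1 / \<beta>) * ((ln_ratio (y $ i $ j) (v $ i) + ereal (\<alpha> i j)) * ereal (y $ i $ j))
       - ereal (b i j * (d $ i $ j - y $ i $ j)) = T (i, j)"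
      by (auto simp: T_def add_divide_distrib)
  qed
  show ?thesis
  proof (cases "\<forall>(i, j)\<in>E. y $ i $ j = 0 \<or> 0 < v $ i")
    case True
    have "sum T E = (\<Sum>e\<in>E. ereal (case e of (i, j) \<Rightarrow>
        r i j (d $ i $ j) * (d $ i $ j) - \<alpha> i j / \<beta> * (y $ i $ j)
          - y $ i $ j * ln (y $ i $ j / v $ i) / \<beta> - b i j * (d $ i $ j - y $ i $ j)))"
      using True by (intro sum.cong) (auto simp: T_def split: prod.splits)
    with True show ?thesis by (simp add: obj)
  next
    case False
    then obtain i j where ij: "(i, j) \<in> E" "\<not> (y $ i $ j = 0 \<or> 0 < v $ i)" by auto
    define e where "e = (i, j)"
    have e: "e \<in> E" "T e = -\<infinity>" using ij by (simp_all add: T_def e_def)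
    have "sum T E = T e + sum T (E - {e})"
      using e by (intro sum.remove) auto
    moreover have "sum T (E - {e}) \<noteq> \<infinity>"
      by (auto simp: sum_Pinfty T_def split: if_splits)
    ultimately have "sum T E = -\<infinity>"
      using e by (cases "sum T (E - {e})") auto
    with False show ?thesis by (simp add: obj)
  qed
qed

text \<open>The cone constraint bounds \<open>v\<close> only at nodes with an outgoing edge; at any other node
  \<open>v\<close> equals the total inflow, which is nonnegative.\<close>

lemma CONIC_project:
  fixes E :: "('n::finite \<times> 'n) set"
  assumes \<beta>: "0 < \<beta>" and q: "\<And>i j. (i, j) \<in> E \<Longrightarrow> 0 \<le> q i j" and lam: "\<And>j. 0 \<le> lam j"
    and C: "(d, y, v, \<tau>) \<in> CONIC_feasible E \<beta> q lam"
  shows "(d, y, v) \<in> FA_feasible E q lam"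
    and "ereal (CONIC_objective E \<beta> \<alpha> b r (d, y, v, \<tau>)) \<le> FA_objective E \<beta> \<alpha> b r (d, y, v)"
proof -
  have bal: "flow_balance E q lam y v"
    and K: "\<And>i j. (i, j) \<in> E \<Longrightarrow> (v $ i, y $ i $ j, - \<beta> * (\<tau> $ i $ j)) \<in> K_exp"
    using C by (auto simp: CONIC_feasible_def)
  note K = K[unfolded K_exp_iff[OF \<beta>]]
  have v0: "0 \<le> v $ j" for j
  proof (cases "out_nbrs E j = {}")
    case True
    with bal have "v $ j = (\<Sum>i\<in>in_nbrs E j. q i j * (y $ i $ j)) + lam j"
      by (simp add: flow_balance_def)
    also have "0 \<le> \<dots>"
      by (intro add_nonneg_nonneg sum_nonneg lam mult_nonneg_nonneg) (auto simp: in_nbrs_def q K)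
    finally show ?thesis .
  next
    case False
    then show ?thesis using K by (auto simp: out_nbrs_def)
  qed
  show FA: "(d, y, v) \<in> FA_feasible E q lam"
    using C K v0 by (auto simp: CONIC_feasible_def FA_feasible_def)
  have proper: "\<forall>(i, j)\<in>E. y $ i $ j = 0 \<or> 0 < v $ i"
    using K by blast
  show "ereal (CONIC_objective E \<beta> \<alpha> b r (d, y, v, \<tau>)) \<le> FA_objective E \<beta> \<alpha> b r (d, y, v)"
    unfolding FA_objective_eq[OF \<beta> FA] if_P[OF proper] CONIC_objective_def prod.case ereal_less_eq
    using K by (intro sum_mono) force
qed

text \<open>The smallest admissible \<open>\<tau>\<close> gives equality.  It vanishes outside \<open>E\<close> because \<open>y\<close> does.\<close>

lemma FA_lift:
  fixes E :: "('n::finite \<times> 'n) set"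
  assumes \<beta>: "0 < \<beta>" and FA: "(d, y, v) \<in> FA_feasible E q lam"
    and fin: "FA_objective E \<beta> \<alpha> b r (d, y, v) \<noteq> -\<infinity>"
  obtains \<tau> where "(d, y, v, \<tau>) \<in> CONIC_feasible E \<beta> q lam"
    "FA_objective E \<beta> \<alpha> b r (d, y, v) = ereal (CONIC_objective E \<beta> \<alpha> b r (d, y, v, \<tau>))"
proof -
  define \<tau> :: "real^'n^'n" where "\<tau> = (\<chi> i j. y $ i $ j * ln (y $ i $ j / v $ i) / \<beta>)"
  have proper: "\<forall>(i, j)\<in>E. y $ i $ j = 0 \<or> 0 < v $ i"
    using fin unfolding FA_objective_eq[OF \<beta> FA] by presburger
  have "edge_vec E \<tau>"
    using FA by (simp add: \<tau>_def edge_vec_def FA_feasible_def)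
  moreover have "(v $ i, y $ i $ j, - \<beta> * (\<tau> $ i $ j)) \<in> K_exp" if "(i, j) \<in> E" for i j
    unfolding K_exp_iff[OF \<beta>] using FA proper that by (auto simp: FA_feasible_def \<tau>_def)
  ultimately have "(d, y, v, \<tau>) \<in> CONIC_feasible E \<beta> q lam"
    using FA by (auto simp: FA_feasible_def CONIC_feasible_def)
  moreover have
    "FA_objective E \<beta> \<alpha> b r (d, y, v) = ereal (CONIC_objective E \<beta> \<alpha> b r (d, y, v, \<tau>))"
    unfolding FA_objective_eq[OF \<beta> FA] if_P[OF proper] by (simp add: CONIC_objective_def \<tau>_def)
  ultimately show thesis by (rule that)
qed

lemma opt_value_FA_eq_CONIC:
  fixes E :: "('n::finite \<times> 'n) set"
  assumes \<beta>: "0 < \<beta>" and q: "\<And>i j. (i, j) \<in> E \<Longrightarrow> 0 \<le> q i j" and lam: "\<And>j. 0 \<le> lam j"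
  shows "opt_value (FA_feasible E q lam) (FA_objective E \<beta> \<alpha> b r)
           = opt_value (CONIC_feasible E \<beta> q lam) (\<lambda>z. ereal (CONIC_objective E \<beta> \<alpha> b r z))"
  unfolding opt_value_def
proof (rule antisym)
  show "(SUP z\<in>FA_feasible E q lam. FA_objective E \<beta> \<alpha> b r z)
      \<le> (SUP z\<in>CONIC_feasible E \<beta> q lam. ereal (CONIC_objective E \<beta> \<alpha> b r z))"
  proof (rule SUP_least)
    fix z assume z: "z \<in> FA_feasible E q lam"
    obtain d y v where [simp]: "z = (d, y, v)" by (cases z)
    show "FA_objective E \<beta> \<alpha> b r z
        \<le> (SUP z\<in>CONIC_feasible E \<beta> q lam. ereal (CONIC_objective E \<beta> \<alpha> b r z))"
    proof (cases "FA_objective E \<beta> \<alpha> b r z = -\<infinity>")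
      case False
      then obtain \<tau> where "(d, y, v, \<tau>) \<in> CONIC_feasible E \<beta> q lam"
        "FA_objective E \<beta> \<alpha> b r z = ereal (CONIC_objective E \<beta> \<alpha> b r (d, y, v, \<tau>))"
        using FA_lift[OF \<beta>] z by (metis \<open>z = (d, y, v)\<close>)
      then show ?thesis by (metis SUP_upper)
    qed simp
  qed
  show "(SUP z\<in>CONIC_feasible E \<beta> q lam. ereal (CONIC_objective E \<beta> \<alpha> b r z))
      \<le> (SUP z\<in>FA_feasible E q lam. FA_objective E \<beta> \<alpha> b r z)"
  proof (rule SUP_mono, clarify)
    fix d y v \<tau> assume "(d, y, v, \<tau>) \<in> CONIC_feasible E \<beta> q lam"
    from CONIC_project[OF \<beta> q lam this]
    show "\<exists>z\<in>FA_feasible E q lam. ereal (CONIC_objective E \<beta> \<alpha> b r (d, y, v, \<tau>))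
        \<le> FA_objective E \<beta> \<alpha> b r z"
      by blast
  qed
qed


section \<open>Convexity\<close>

lemma edge_vec_combination:
  "edge_vec E x \<Longrightarrow> edge_vec E y \<Longrightarrow> edge_vec E (s *\<^sub>R x + t *\<^sub>R y)"
  by (simp add: edge_vec_def)

lemma flow_balance_combination:
  assumes "flow_balance E q lam y v" "flow_balance E q lam y' v'" and st: "s + t = 1"
  shows "flow_balance E q lam (s *\<^sub>R y + t *\<^sub>R y') (s *\<^sub>R v + t *\<^sub>R v')"
  unfolding flow_balance_def
proof
  fix j
  have 1: "(\<Sum>i\<in>in_nbrs E j. q i j * (y $ i $ j)) + lam j = (\<Sum>k\<in>out_nbrs E j. y $ j $ k) + v $ j"
    and 2: "(\<Sum>i\<in>in_nbrs E j. q i j * (y' $ i $ j)) + lam j = (\<Sum>k\<in>out_nbrs E j. y' $ j $ k) + v' $ j"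
    using assms(1,2) by (auto simp: flow_balance_def)
  have "lam j = s * lam j + t * lam j"
    using st by (simp flip: distrib_right)
  then have "(\<Sum>i\<in>in_nbrs E j. q i j * ((s *\<^sub>R y + t *\<^sub>R y') $ i $ j)) + lam j
      = s * ((\<Sum>i\<in>in_nbrs E j. q i j * (y $ i $ j)) + lam j)
        + t * ((\<Sum>i\<in>in_nbrs E j. q i j * (y' $ i $ j)) + lam j)"
    by (simp add: distrib_left sum.distrib sum_distrib_left mult_ac)
  also have "\<dots> = (\<Sum>k\<in>out_nbrs E j. (s *\<^sub>R y + t *\<^sub>R y') $ j $ k) + (s *\<^sub>R v + t *\<^sub>R v') $ j"
    unfolding 1 2 by (simp add: distrib_left sum.distrib sum_distrib_left)
  finally show "(\<Sum>i\<in>in_nbrs E j. q i j * ((s *\<^sub>R y + t *\<^sub>R y') $ i $ j)) + lam j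
      = (\<Sum>k\<in>out_nbrs E j. (s *\<^sub>R y + t *\<^sub>R y') $ j $ k) + (s *\<^sub>R v + t *\<^sub>R v') $ j" .
qed

lemma convex_FA_feasible:
  fixes E :: "('n::finite \<times> 'n) set"
  shows "convex (FA_feasible E q lam)"
proof (rule convexI)
  fix z z' :: "'n fa_vars" and s t :: real
  assume z: "z \<in> FA_feasible E q lam" "z' \<in> FA_feasible E q lam" and st: "0 \<le> s" "0 \<le> t" "s + t = 1"
  obtain d y v where [simp]: "z = (d, y, v)" by (cases z)
  obtain d' y' v' where [simp]: "z' = (d', y', v')" by (cases z')
  show "s *\<^sub>R z + t *\<^sub>R z' \<in> FA_feasible E q lam"
    using z st
    by (auto simp: FA_feasible_def edge_vec_combination flow_balance_combination
        intro!: add_nonneg_nonneg mult_nonneg_nonneg add_mono mult_left_mono)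
qed

lemma convex_CONIC_feasible:
  fixes E :: "('n::finite \<times> 'n) set"
  shows "convex (CONIC_feasible E \<beta> q lam)"
proof (rule convexI)
  fix z z' :: "'n conic_vars" and s t :: real
  assume z: "z \<in> CONIC_feasible E \<beta> q lam" "z' \<in> CONIC_feasible E \<beta> q lam"
    and st: "0 \<le> s" "0 \<le> t" "s + t = 1"
  obtain d y v \<tau> where [simp]: "z = (d, y, v, \<tau>)" by (cases z)
  obtain d' y' v' \<tau>' where [simp]: "z' = (d', y', v', \<tau>')" by (cases z')
  have "(s * v $ i + t * v' $ i, s * y $ i $ j + t * y' $ i $ j,
          - (\<beta> * (s * \<tau> $ i $ j + t * \<tau>' $ i $ j))) \<in> K_exp" if "(i, j) \<in> E" for i j
  proof -
    have "s *\<^sub>R (v $ i, y $ i $ j, - \<beta> * (\<tau> $ i $ j))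
        + t *\<^sub>R (v' $ i, y' $ i $ j, - \<beta> * (\<tau>' $ i $ j)) \<in> K_exp"
      using z that st by (intro K_exp_add K_exp_scaleR) (auto simp: CONIC_feasible_def)
    then show ?thesis by (simp add: algebra_simps)
  qed
  then show "s *\<^sub>R z + t *\<^sub>R z' \<in> CONIC_feasible E \<beta> q lam"
    using z st
    by (auto simp: CONIC_feasible_def edge_vec_combination flow_balance_combination
        intro!: add_mono mult_left_mono)
qed

text \<open>Concavity of the revenue is only assumed for nonnegative demand; membership of \<open>y\<close> in the
  cone gives \<open>0 \<le> y \<le> d\<close>.\<close>

lemma concave_CONIC_objective:
  fixes E :: "('n::finite \<times> 'n) set"
  assumes conc: "\<And>i j. (i, j) \<in> E \<Longrightarrow> concave_on {0..} (\<lambda>x. r i j x * x)"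
  shows "concave_on (CONIC_feasible E \<beta> q lam) (CONIC_objective E \<beta> \<alpha> b r)"
  unfolding concave_on_iff
proof (intro conjI ballI allI impI)
  show "convex (CONIC_feasible E \<beta> q lam)" by (rule convex_CONIC_feasible)
next
  fix z z' :: "'n conic_vars" and s t :: real
  assume z: "z \<in> CONIC_feasible E \<beta> q lam" "z' \<in> CONIC_feasible E \<beta> q lam"
    and st: "0 \<le> s" "0 \<le> t" "s + t = 1"
  define T :: "'n conic_vars \<Rightarrow> 'n \<times> 'n \<Rightarrow> real" where
    "T = (\<lambda>(d, y, v, \<tau>) (i, j). r i j (d $ i $ j) * (d $ i $ j) - \<alpha> i j / \<beta> * (y $ i $ j)
       - \<tau> $ i $ j - b i j * (d $ i $ j - y $ i $ j))"
  have obj: "CONIC_objective E \<beta> \<alpha> b r = (\<lambda>z. sum (T z) E)"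
    by (simp add: CONIC_objective_def T_def fun_eq_iff)
  have "s * T z e + t * T z' e \<le> T (s *\<^sub>R z + t *\<^sub>R z') e" if "e \<in> E" for e
  proof -
    obtain d y v \<tau> where [simp]: "z = (d, y, v, \<tau>)" by (cases z)
    obtain d' y' v' \<tau>' where [simp]: "z' = (d', y', v', \<tau>')" by (cases z')
    obtain i j where [simp]: "e = (i, j)" by (cases e)
    have "0 \<le> d $ i $ j" "0 \<le> d' $ i $ j"
      using z that by (force simp: CONIC_feasible_def K_exp_def)+
    then have "s * (r i j (d $ i $ j) * d $ i $ j) + t * (r i j (d' $ i $ j) * d' $ i $ j)
        \<le> r i j (s * d $ i $ j + t * d' $ i $ j) * (s * d $ i $ j + t * d' $ i $ j)"
      using conc[of i j] that st by (auto simp: concave_on_iff)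
    then show ?thesis by (simp add: T_def algebra_simps add_divide_distrib)
  qed
  then show "s * CONIC_objective E \<beta> \<alpha> b r z + t * CONIC_objective E \<beta> \<alpha> b r z'
      \<le> CONIC_objective E \<beta> \<alpha> b r (s *\<^sub>R z + t *\<^sub>R z')"
    unfolding obj sum_distrib_left sum.distrib[symmetric] by (rule sum_mono)
qed

text \<open>Where either value is \<open>-\<infinity>\<close> with positive weight there is nothing to prove.  Otherwise the
  objective of (FA) is, at both points, a value of the concave objective of (CONIC) at a lifted
  point; the combination of the lifted points projects to the combination of the given ones.\<close>

lemma ereal_concave_FA_objective:
  fixes E :: "('n::finite \<times> 'n) set"
  assumes \<beta>: "0 < \<beta>" and q: "\<And>i j. (i, j) \<in> E \<Longrightarrow> 0 \<le> q i j" and lam: "\<And>j. 0 \<le> lam j"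
    and conc: "\<And>i j. (i, j) \<in> E \<Longrightarrow> concave_on {0..} (\<lambda>x. r i j x * x)"
  shows "ereal_concave_on (FA_feasible E q lam) (FA_objective E \<beta> \<alpha> b r)"
  unfolding ereal_concave_on_def
proof (intro conjI ballI allI impI)
  let ?F = "FA_objective E \<beta> \<alpha> b r" and ?C = "CONIC_objective E \<beta> \<alpha> b r"
  show "convex (FA_feasible E q lam)" by (rule convex_FA_feasible)
  show not_inf: "?F z \<noteq> \<infinity>" if "z \<in> FA_feasible E q lam" for z
    using that by (cases z) (simp add: FA_objective_eq[OF \<beta>])
  fix z z' :: "'n fa_vars" and s t :: real
  assume z: "z \<in> FA_feasible E q lam" "z' \<in> FA_feasible E q lam"
    and st: "0 \<le> s" "0 \<le> t" "s + t = 1"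
  consider "s = 0" "t = 1" | "t = 0" "s = 1" | "0 < s" "0 < t" "?F z = -\<infinity> \<or> ?F z' = -\<infinity>"
    | "?F z \<noteq> -\<infinity>" "?F z' \<noteq> -\<infinity>"
    using st by fastforce
  then show "ereal s * ?F z + ereal t * ?F z' \<le> ?F (s *\<^sub>R z + t *\<^sub>R z')"
  proof cases
    case 3
    then have "ereal s * ?F z + ereal t * ?F z' = -\<infinity>"
      using not_inf[OF z(1)] not_inf[OF z(2)] by (cases "?F z"; cases "?F z'") auto
    then show ?thesis by (simp only: ereal_less_eq)
  next
    case 4
    obtain d y v where zeq [simp]: "z = (d, y, v)" by (cases z)
    obtain d' y' v' where zeq' [simp]: "z' = (d', y', v')" by (cases z')
    obtain \<tau> where \<tau>: "(d, y, v, \<tau>) \<in> CONIC_feasible E \<beta> q lam" "?F z = ereal (?C (d, y, v, \<tau>))"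
      unfolding zeq by (rule FA_lift[OF \<beta> z(1)[unfolded zeq] 4(1)[unfolded zeq]])
    obtain \<tau>' where \<tau>': "(d', y', v', \<tau>') \<in> CONIC_feasible E \<beta> q lam"
      "?F z' = ereal (?C (d', y', v', \<tau>'))"
      unfolding zeq' by (rule FA_lift[OF \<beta> z(2)[unfolded zeq'] 4(2)[unfolded zeq']])
    let ?p = "s *\<^sub>R (d, y, v, \<tau>) + t *\<^sub>R (d', y', v', \<tau>')"
    have "?p \<in> CONIC_feasible E \<beta> q lam"
      by (rule convexD[OF convex_CONIC_feasible \<tau>(1) \<tau>'(1) st])
    then have "ereal (?C ?p) \<le> ?F (s *\<^sub>R z + t *\<^sub>R z')"
      using CONIC_project(2)[OF \<beta> q lam] by simp
    moreover have "s * ?C (d, y, v, \<tau>) + t * ?C (d', y', v', \<tau>') \<le> ?C ?p"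
      by (rule concave_CONIC_objective[OF conc, unfolded concave_on_iff, THEN conjunct2,
            rule_format, OF _ \<tau>(1) \<tau>'(1) st])
    then have "ereal s * ?F z + ereal t * ?F z' \<le> ereal (?C ?p)"
      unfolding \<tau>(2) \<tau>'(2) times_ereal.simps plus_ereal.simps ereal_less_eq .
    ultimately show ?thesis by (rule order_trans[rotated])
  qed (simp_all add: zero_ereal_def[symmetric] one_ereal_def[symmetric])
qed


section \<open>Equivalence of the three problems\<close>

theorem mainTheorem5:
  fixes E :: "('n::finite \<times> 'n) set"
    and \<beta> :: real
    and \<alpha> b q :: "'n \<Rightarrow> 'n \<Rightarrow> real"
    and lam :: "'n \<Rightarrow> real"
    and r :: "'n \<Rightarrow> 'n \<Rightarrow> real \<Rightarrow> real"
  assumes "0 < \<beta>"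
    and "\<And>i j. (i, j) \<in> E \<Longrightarrow> 0 < \<alpha> i j"
    and "\<And>i j. (i, j) \<in> E \<Longrightarrow> 0 < q i j \<and> q i j < 1"
    and "\<And>j. 0 < lam j"
  shows "opt_value (A_feasible E q lam) (A_objective E \<beta> \<alpha> b r)
           = opt_value (FA_feasible E q lam) (FA_objective E \<beta> \<alpha> b r)
    \<and> ((\<forall>(i, j)\<in>E. concave_on {0..} (\<lambda>x. r i j x * x)) \<longrightarrow>
         convex (FA_feasible E q lam)
       \<and> ereal_concave_on (FA_feasible E q lam) (FA_objective E \<beta> \<alpha> b r)
       \<and> opt_value (FA_feasible E q lam) (FA_objective E \<beta> \<alpha> b r)
           = opt_value (CONIC_feasible E \<beta> q lam) (\<lambda>z. ereal (CONIC_objective E \<beta> \<alpha> b r z))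
       \<and> convex K_exp \<and> cone K_exp
       \<and> convex (CONIC_feasible E \<beta> q lam)
       \<and> concave_on (CONIC_feasible E \<beta> q lam) (CONIC_objective E \<beta> \<alpha> b r))"
proof -
  have q: "\<And>i j. (i, j) \<in> E \<Longrightarrow> 0 \<le> q i j" and lam: "\<And>j. 0 \<le> lam j"
    using assms(3,4) by (simp_all add: less_imp_le)
  show ?thesis
    by (intro conjI impI opt_value_A_eq_FA opt_value_FA_eq_CONIC convex_FA_feasible
        convex_CONIC_feasible convex_cone_K_exp ereal_concave_FA_objective
        concave_CONIC_objective assms q lam) auto
qed

end
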